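(* Let $I=(P,F,G,S)$ be an instance of Seat Arrangement with S-utility and $1$-dimensional preferences with unique positions, whose seat graph $G$ has at least one connected component that is a path with at least three vertices or a cycle with at least four vertices. Then $I$ has no envy-free arrangement.
   Context: An instance $I=(P,F,G,U)$ of Seat Arrangement consists of a finite set $P$ of agents; for each $p\in P$ a valuation function $f_p:P\setminus\{p\}\to\mathbb{R}$; an undirected simple graph $G$ (the seat graph) with $|V(G)|=|P|$; and a utility type. An arrangement is a bijection $\sigma:P\to V(G)$. Under S-utility, $u_\sigma(p)=\sum_{v\in N(\sigma(p))} f_p(\sigma^{-1}(v))$, where $N(\sigma(p))$ is the set of neighbours of $\sigma(p)$ in $G$ (empty sum $=0$). For distinct $p,q$, $\sigma^{p\leftrightarrow q}$ is $\sigma$ with the seats of $p$ and $q$ swapped; $p$ envies $q$ under $\sigma$ if $u_\sigma(p)<u_{\sigma^{p\leftrightarrow q}}(p)$; $\sigma$ is envy-free if no agent envies another. Preferences are $1$-dimensional if each agent $p$ has a location $l_p\in\mathbb{R}$, $d(p,q)=|l_p-l_q|$, $D=\max_p l_p-\min_p l_p$, and $f_p(q)=D-d(p,q)+1$; positions are unique if no two agents share a location. *)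

theory Defs
  imports "Graph_Theory.Graph_Theory"
begin

text \<open>
  Agents form a set \<open>P :: 'a set\<close>, and \<open>f p q\<close> is the valuation that \<open>p\<close> has for \<open>q\<close>;
  it is meaningful only for distinct \<open>p\<close>, \<open>q\<close> in \<open>P\<close>. The seat graph is a \<^locale>\<open>pair_graph\<close>,
  i.e. a finite, loop-free, symmetric relation on a vertex set; being symmetric, its strongly
  connected components (\<open>sccs\<close>) are its connected components as an undirected graph.
\<close>

definition arrangement :: "'a set \<Rightarrow> 'v pair_pre_digraph \<Rightarrow> ('a \<Rightarrow> 'v) \<Rightarrow> bool" where
  "arrangement P G \<sigma> \<longleftrightarrow> bij_betw \<sigma> P (pverts G)"

definition neighbours :: "'v pair_pre_digraph \<Rightarrow> 'v \<Rightarrow> 'v set" where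
  "neighbours G v = {w. (v, w) \<in> parcs G}"

definition S_utility ::
  "'a set \<Rightarrow> ('a \<Rightarrow> 'a \<Rightarrow> real) \<Rightarrow> 'v pair_pre_digraph \<Rightarrow> ('a \<Rightarrow> 'v) \<Rightarrow> 'a \<Rightarrow> real" where
  "S_utility P f G \<sigma> p = (\<Sum>v\<in>neighbours G (\<sigma> p). f p (inv_into P \<sigma> v))"

definition swap_seats :: "('a \<Rightarrow> 'v) \<Rightarrow> 'a \<Rightarrow> 'a \<Rightarrow> 'a \<Rightarrow> 'v" where
  "swap_seats \<sigma> p q = \<sigma>(p := \<sigma> q, q := \<sigma> p)"

definition envies ::
  "'a set \<Rightarrow> ('a \<Rightarrow> 'a \<Rightarrow> real) \<Rightarrow> 'v pair_pre_digraph \<Rightarrow> ('a \<Rightarrow> 'v) \<Rightarrow> 'a \<Rightarrow> 'a \<Rightarrow> bool" where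
  "envies P f G \<sigma> p q \<longleftrightarrow> S_utility P f G \<sigma> p < S_utility P f G (swap_seats \<sigma> p q) p"

definition envy_free ::
  "'a set \<Rightarrow> ('a \<Rightarrow> 'a \<Rightarrow> real) \<Rightarrow> 'v pair_pre_digraph \<Rightarrow> ('a \<Rightarrow> 'v) \<Rightarrow> bool" where
  "envy_free P f G \<sigma> \<longleftrightarrow> (\<forall>p\<in>P. \<forall>q\<in>P. p \<noteq> q \<longrightarrow> \<not> envies P f G \<sigma> p q)"

definition one_dimensional :: "'a set \<Rightarrow> ('a \<Rightarrow> 'a \<Rightarrow> real) \<Rightarrow> ('a \<Rightarrow> real) \<Rightarrow> bool" where
  "one_dimensional P f l \<longleftrightarrow>
     (\<forall>p\<in>P. \<forall>q\<in>P. p \<noteq> q \<longrightarrow> f p q = (Max (l ` P) - Min (l ` P)) - \<bar>l p - l q\<bar> + 1)"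

definition path_graph :: "nat \<Rightarrow> nat pair_pre_digraph" where
  "path_graph n = \<lparr> pverts = {..<n},
     parcs = {(i, j). i < n \<and> j < n \<and> (j = Suc i \<or> i = Suc j)} \<rparr>"

text \<open>The following is a simple graph, namely the cycle on \<open>n\<close> vertices, only for \<open>n \<ge> 3\<close>.\<close>

definition cycle_graph :: "nat \<Rightarrow> nat pair_pre_digraph" where
  "cycle_graph n = \<lparr> pverts = {..<n},
     parcs = {(i, j). i < n \<and> j < n \<and> (j = Suc i mod n \<or> i = Suc j mod n)} \<rparr>"

end

theory Submission
  imports Defs
begin

text \<open>
  Only exchanges between neighbouring seats are needed. On a path, the agent at an end seat envies
  its unique neighbour, since values are positive and the move keeps that neighbour and adds another.
  On a cycle, let \<open>p\<close> be the leftmost agent, with neighbours \<open>a\<close> and \<open>b\<close> where \<open>a\<close> is closer to \<open>p\<close>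
  than \<open>b\<close>, and let \<open>c\<close> be the other neighbour of \<open>a\<close>. As \<open>p\<close> does not envy \<open>a\<close>, \<open>b\<close> is
  at most as far from \<open>p\<close> as \<open>c\<close>, so \<open>c\<close> does not lie left of \<open>b\<close>; as \<open>a\<close> does not envy \<open>p\<close>,
  \<open>c\<close> does not lie right of \<open>b\<close>. Hence \<open>b = c\<close>, and the cycle is a triangle.
\<close>

section \<open>Utilities after an exchange of seats\<close>

lemma S_utility_swap_seats:
  assumes G: "pair_graph G" and \<sigma>: "arrangement P G \<sigma>"
    and pq: "p \<in> P" "q \<in> P" "p \<noteq> q"
  shows "S_utility P f G (swap_seats \<sigma> p q) p =
    (\<Sum>v\<in>neighbours G (\<sigma> q). f p (if v = \<sigma> p then q else inv_into P \<sigma> v))"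
proof -
  interpret pair_graph G by (fact G)
  have bij: "bij_betw \<sigma> P (pverts G)"
    using \<sigma> by (simp add: arrangement_def)
  have inj: "inj_on (swap_seats \<sigma> p q) P"
    using bij pq unfolding bij_betw_def inj_on_def swap_seats_def by auto
  have inv: "inv_into P (swap_seats \<sigma> p q) v = (if v = \<sigma> p then q else inv_into P \<sigma> v)"
    if v: "v \<in> neighbours G (\<sigma> q)" for v
  proof -
    \<comment> \<open>Without loops the seat \<open>\<sigma> q\<close> is not its own neighbour, so
      \<open>q\<close>, now at \<open>\<sigma> p\<close>, is the only displaced agent that
      \<open>p\<close> can meet there.\<close>
    have v': "v \<in> pverts G" "v \<noteq> \<sigma> q"
      using v by (auto simp: neighbours_def dest: no_loops in_arcsD2)
    obtain r where r: "r \<in> P" "\<sigma> r = v"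
      using v'(1) bij by (metis bij_betw_imp_surj_on imageE)
    have "inv_into P \<sigma> v = r"
      using r bij by (auto simp: bij_betw_def)
    moreover have "r \<noteq> q" "v = \<sigma> p \<longleftrightarrow> r = p"
      using v' r pq bij by (auto simp: bij_betw_def inj_on_def)
    ultimately show ?thesis
      using inj r pq by (intro inv_into_f_eq) (auto simp: swap_seats_def)
  qed
  have "swap_seats \<sigma> p q p = \<sigma> q"
    using pq by (simp add: swap_seats_def)
  then show ?thesis
    unfolding S_utility_def by (intro sum.cong) (auto simp: inv)
qed

text \<open>When adjacent agents exchange seats they stay neighbours, so the value of the occupant
  of \<open>w\<close> occurs before and after the swap and cancels. What remains compares the other
  neighbours of the two seats.\<close>

lemma envy_free_adjacent:
  fixes f :: "'a \<Rightarrow> 'a \<Rightarrow> real"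
  assumes G: "pair_graph G" and \<sigma>: "arrangement P G \<sigma>" and ef: "envy_free P f G \<sigma>"
    and uw: "w \<in> neighbours G u"
  defines "F \<equiv> \<lambda>v. f (inv_into P \<sigma> u) (inv_into P \<sigma> v)"
  shows "sum F (neighbours G w - {u}) \<le> sum F (neighbours G u - {w})"
proof -
  interpret pair_graph G by (fact G)
  have bij: "bij_betw \<sigma> P (pverts G)"
    using \<sigma> by (simp add: arrangement_def)
  have fin: "finite (neighbours G v)" for v
    by (rule finite_subset[of _ "pverts G"]) (auto simp: neighbours_def dest: in_arcsD2)
  have V: "u \<in> pverts G" "w \<in> pverts G" "u \<noteq> w"
    using uw by (auto simp: neighbours_def dest: no_loops in_arcsD1 in_arcsD2)
  have wu: "u \<in> neighbours G w"
    using uw arcs_symmetric by (auto simp: neighbours_def)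
  define p q where "p = inv_into P \<sigma> u" and "q = inv_into P \<sigma> w"
  have P: "p \<in> P" "q \<in> P" "\<sigma> p = u" "\<sigma> q = w"
    using V bij unfolding p_def q_def by (auto simp: bij_betw_def inv_into_into f_inv_into_f)
  have "p \<noteq> q"
    using P V by auto
  moreover from this have "\<not> envies P f G \<sigma> p q"
    using ef P by (auto simp: envy_free_def)
  ultimately have "(\<Sum>v\<in>neighbours G w. f p (if v = u then q else inv_into P \<sigma> v))
      \<le> S_utility P f G \<sigma> p"
    using S_utility_swap_seats[OF G \<sigma>, of p q f] P by (simp add: envies_def not_less)
  also have "S_utility P f G \<sigma> p = (\<Sum>v\<in>neighbours G u. f p (inv_into P \<sigma> v))"
    by (simp add: S_utility_def P)
  also have "(\<Sum>v\<in>neighbours G w. f p (if v = u then q else inv_into P \<sigma> v))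
      = f p q + (\<Sum>v\<in>neighbours G w - {u}. f p (if v = u then q else inv_into P \<sigma> v))"
    by (simp add: sum.remove[OF fin wu])
  also have "(\<Sum>v\<in>neighbours G w - {u}. f p (if v = u then q else inv_into P \<sigma> v))
      = sum F (neighbours G w - {u})"
    by (intro sum.cong) (auto simp: F_def p_def)
  also have "(\<Sum>v\<in>neighbours G u. f p (inv_into P \<sigma> v)) = f p q + sum F (neighbours G u - {w})"
    by (simp add: sum.remove[OF fin uw] F_def p_def q_def)
  finally show ?thesis
    by simp
qed

section \<open>Local configurations that force envy\<close>

lemma one_dimensional_pos:
  assumes "finite P" "one_dimensional P f l" "p \<in> P" "q \<in> P" "p \<noteq> q"
  shows "f p q > 0"
proof -
  \<comment> \<open>A distance never exceeds the spread of all locations; the summand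
    \<open>1\<close> then makes the value strictly positive.\<close>
  have "Min (l ` P) \<le> l p" "Min (l ` P) \<le> l q" "l p \<le> Max (l ` P)" "l q \<le> Max (l ` P)"
    using assms by auto
  moreover have "f p q = Max (l ` P) - Min (l ` P) - \<bar>l p - l q\<bar> + 1"
    using assms by (simp add: one_dimensional_def)
  ultimately show ?thesis
    by linarith
qed

text \<open>After the cancellation the seat \<open>v\<close> has nothing left to offer, whereas
  \<open>w\<close> still offers the positive value of the occupant of \<open>x\<close>.\<close>

lemma not_envy_free_leaf:
  assumes P: "finite P" and G: "pair_graph G" and \<sigma>: "arrangement P G \<sigma>"
    and od: "one_dimensional P f l"
    and v: "neighbours G v = {w}" and w: "x \<in> neighbours G w" "x \<noteq> v"
  shows "\<not> envy_free P f G \<sigma>"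
proof
  assume ef: "envy_free P f G \<sigma>"
  interpret pair_graph G by (fact G)
  let ?s = "inv_into P \<sigma>" and ?N = "neighbours G w - {v}"
  have bij: "bij_betw ?s (pverts G) P"
    using \<sigma> by (simp add: arrangement_def bij_betw_inv_into)
  have fin: "finite ?N"
    by (rule finite_subset[of _ "pverts G"]) (auto simp: neighbours_def dest: in_arcsD2)
  have "(v, w) \<in> parcs G"
    using v by (auto simp: neighbours_def)
  then have vV: "v \<in> pverts G"
    by (rule in_arcsD1)
  have "f (?s v) (?s y) > 0" if "y \<in> ?N" for y
  proof (rule one_dimensional_pos[OF P od])
    have "y \<in> pverts G" "y \<noteq> v"
      using that in_arcsD2 by (auto simp: neighbours_def)
    then show "?s v \<in> P" "?s y \<in> P" "?s v \<noteq> ?s y"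
      using bij vV by (auto simp: bij_betw_def inj_on_def)
  qed
  then have "0 < (\<Sum>y\<in>?N. f (?s v) (?s y))"
    using fin w by (intro sum_pos) auto
  also have "\<dots> \<le> (\<Sum>y\<in>neighbours G v - {w}. f (?s v) (?s y))"
    using v by (intro envy_free_adjacent[OF G \<sigma> ef]) simp
  finally show False
    by (simp add: v)
qed

text \<open>A cycle enters only through conditions on neighbourhoods, so no cyclic numbering is
  carried through the argument. Here \<open>p\<close>, \<open>a\<close>, \<open>b\<close>,
  \<open>c\<close> are seats and \<open>x\<close> gives the location of the occupant.\<close>

lemma not_envy_free_2_regular:
  assumes P: "finite P" and G: "pair_graph G" and \<sigma>: "arrangement P G \<sigma>"
    and od: "one_dimensional P f l" and inj: "inj_on l P"
    and C: "C \<subseteq> pverts G" "C \<noteq> {}"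
    and closed: "\<And>v. v \<in> C \<Longrightarrow> neighbours G v \<subseteq> C"
    and two: "\<And>v. v \<in> C \<Longrightarrow> card (neighbours G v) = 2"
    and no_triangle: "\<And>u v. \<lbrakk>u \<in> C; v \<in> neighbours G u\<rbrakk> \<Longrightarrow> neighbours G u \<inter> neighbours G v = {}"
  shows "\<not> envy_free P f G \<sigma>"
proof
  assume ef: "envy_free P f G \<sigma>"
  interpret pair_graph G by (fact G)
  let ?s = "inv_into P \<sigma>"
  define x where "x v = l (?s v)" for v
  have bij: "bij_betw ?s (pverts G) P"
    using \<sigma> by (simp add: arrangement_def bij_betw_inv_into)
  have inj_x: "inj_on x (pverts G)"
    unfolding x_def using comp_inj_on[of ?s "pverts G" l] bij inj
    by (simp add: bij_betw_def comp_def)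
  have val: "f (?s u) (?s v) = Max (l ` P) - Min (l ` P) - \<bar>x u - x v\<bar> + 1"
    if "u \<in> pverts G" "v \<in> pverts G" "u \<noteq> v" for u v
    using od bij that unfolding one_dimensional_def x_def
    by (simp add: bij_betw_def inj_on_def image_iff) blast
  have "finite C"
    using finite_subset[OF C(1)] by simp
  \<comment> \<open>Leftmost within \<open>C\<close> is enough: closure keeps \<open>a\<close>,
    \<open>b\<close> and \<open>c\<close> inside \<open>C\<close>.\<close>
  then obtain p where p: "p \<in> C" "\<And>v. v \<in> C \<Longrightarrow> x p \<le> x v"
    using C ex_min_if_finite[of "x ` C"] by (metis arg_min_if_finite(1) arg_min_least)
  have no_loop: "v \<notin> neighbours G v" for v
    by (auto simp: neighbours_def dest: no_loops)
  \<comment> \<open>Unique positions rule out a tie, so the names can be chosen with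
    \<open>x a < x b\<close>; as \<open>p\<close> is leftmost, \<open>a\<close> is the nearer
    one.\<close>
  obtain a b where ab: "neighbours G p = {a, b}" "x a < x b"
  proof -
    obtain a b where "neighbours G p = {a, b}" "a \<noteq> b"
      using two[OF p(1)] by (auto simp: card_2_iff)
    moreover from this have "x a \<noteq> x b"
      using inj_x closed[OF p(1)] C by (auto simp: inj_on_def)
    ultimately show ?thesis
      using that[of a b] that[of b a] by (cases "x a < x b") (auto simp: insert_commute)
  qed
  have aC: "a \<in> C"
    using ab closed[OF p(1)] by auto
  have pa: "p \<in> neighbours G a"
    using ab arcs_symmetric by (auto simp: neighbours_def)
  obtain c where c: "neighbours G a = {p, c}" "c \<noteq> p"
  proof -
    have "card (neighbours G a - {p}) = 1"
      using two[OF aC] pa by simp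
    then obtain c where "neighbours G a - {p} = {c}"
      by (auto simp: card_1_singleton_iff)
    then show ?thesis
      using that[of c] pa by blast
  qed
  \<comment> \<open>If \<open>b = c\<close>, this seat would be adjacent to both \<open>p\<close>
    and \<open>a\<close>, closing a triangle.\<close>
  have "b \<noteq> c"
    using no_triangle[OF p(1), of a] ab c by auto
  have cC: "c \<in> C" "b \<in> C"
    using c ab closed p aC by auto
  have nb: "a \<in> neighbours G p" "b \<in> neighbours G p" "c \<in> neighbours G a"
    using ab c by simp_all
  then have neq: "a \<noteq> p" "b \<noteq> p" "c \<noteq> a"
    by (metis no_loop)+
  have "a \<noteq> b"
    using ab(2) by auto
  have Diff: "neighbours G p - {a} = {b}" "neighbours G a - {p} = {c}"
    unfolding ab(1) c(1) using neq \<open>a \<noteq> b\<close> c(2) by auto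
  have "f (?s p) (?s c) \<le> f (?s p) (?s b)"
    using envy_free_adjacent[OF G \<sigma> ef, of a p] nb(1) by (simp add: Diff)
  \<comment> \<open>Neither \<open>b\<close> nor \<open>c\<close> lies left of \<open>p\<close>, so
    the comparison of distances is one of locations.\<close>
  then have "x b \<le> x c"
    using val[of p c] val[of p b] p cC C c neq by (auto simp: subset_iff)
  moreover have "f (?s a) (?s b) \<le> f (?s a) (?s c)"
    using envy_free_adjacent[OF G \<sigma> ef, of p a] pa by (simp add: Diff)
  then have "\<bar>x a - x c\<bar> \<le> \<bar>x a - x b\<bar>"
    using val[of a c] val[of a b] \<open>a \<noteq> b\<close> aC cC C neq by (auto simp: subset_iff)
  \<comment> \<open>By \<open>x a < x b \<le> x c\<close> both absolute values open with the same
    sign, which leaves \<open>x c \<le> x b\<close>.\<close>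
  ultimately have "x b = x c"
    using ab(2) by linarith
  then show False
    using inj_x cC C \<open>b \<noteq> c\<close> by (auto simp: inj_on_def)
qed

section \<open>From a component to its standard model\<close>

text \<open>Reduces \<open>digraph_iso\<close> to a vertex map that respects neighbourhoods. These
  can be taken in the whole of \<open>G\<close>, since a component contains the neighbours of its
  vertices.\<close>

lemma scc_iso_neighbours:
  assumes G: "pair_graph G" and H: "H \<in> pre_digraph.sccs (with_proj G)"
    and iso: "digraph_iso H (with_proj K)"
  obtains h where "verts H \<subseteq> pverts G" "bij_betw h (verts H) (pverts K)"
    "\<And>v. v \<in> verts H \<Longrightarrow> neighbours G v \<subseteq> verts H"
    "\<And>v. v \<in> verts H \<Longrightarrow> neighbours K (h v) = h ` neighbours G v"
proof -
  interpret pair_graph G by (fact G)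
  obtain hom where hom: "pre_digraph.digraph_isomorphism H hom" "with_proj K = app_iso hom H"
    using iso by (auto simp: digraph_iso_def)
  have ind: "induced_subgraph H (with_proj G)"
    using H by (rule in_sccs_imp_induced)
  then have sub: "verts H \<subseteq> pverts G" and compat: "compatible (with_proj G) H"
    and arcs: "arcs H = {e \<in> parcs G. fst e \<in> verts H \<and> snd e \<in> verts H}"
    by (auto simp: induced_subgraph_def subgraph_def)
  have ends: "arcs_ends H = {e \<in> parcs G. fst e \<in> verts H \<and> snd e \<in> verts H}"
    using compat arcs by (auto simp: compatible_def arcs_ends_conv)
  have scc: "verts H \<in> sccs_verts"
    using H by (intro in_sccs_vertsI_sccs) simp
  have closed: "neighbours G v \<subseteq> verts H" if v: "v \<in> verts H" for v
  proof
    fix w assume "w \<in> neighbours G v"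
    \<comment> \<open>Each arc has its reverse, so its two ends reach each other and share a strong
      component.\<close>
    then have "(v, w) \<in> parcs G" "(w, v) \<in> parcs G"
      using arcs_symmetric by (auto simp: neighbours_def)
    then have "v \<rightarrow>\<^sup>*\<^bsub>with_proj G\<^esub> w" "w \<rightarrow>\<^sup>*\<^bsub>with_proj G\<^esub> v"
      by auto
    then show "w \<in> verts H"
      using scc v unfolding in_sccs_verts_conv_reachable by blast
  qed
  have wf: "wf_digraph H"
    using hom(1) by (simp add: pre_digraph.digraph_isomorphism_def)
  have inj: "inj_on (iso_verts hom) (verts H)"
    using hom(1) by (rule pre_digraph.digraph_isomorphism_inj_on_verts)
  have verts: "pverts K = iso_verts hom ` verts H"
    using arg_cong[OF hom(2), of verts] by simp
  \<comment> \<open>The isomorphism moves arcs by a map of their own; comparing end pairs leaves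
    only its action on vertices.\<close>
  have parcs: "parcs K = (\<lambda>(u, v). (iso_verts hom u, iso_verts hom v)) ` arcs_ends H"
    using wf_digraph.arcs_ends_app_iso_eq[OF wf hom(1)] by (simp flip: hom(2))
  show ?thesis
  proof
    show "verts H \<subseteq> pverts G" by (fact sub)
    show "bij_betw (iso_verts hom) (verts H) (pverts K)"
      using inj verts by (simp add: bij_betw_def)
    show "neighbours G v \<subseteq> verts H" if "v \<in> verts H" for v
      using that by (rule closed)
    show "neighbours K (iso_verts hom v) = iso_verts hom ` neighbours G v" if v: "v \<in> verts H" for v
    proof (intro equalityI subsetI)
      fix y assume "y \<in> neighbours K (iso_verts hom v)"
      then obtain u w where uw: "(u, w) \<in> parcs G" "u \<in> verts H"
        "iso_verts hom v = iso_verts hom u" "y = iso_verts hom w"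
        by (auto simp: neighbours_def parcs ends)
      then have "u = v"
        using inj_onD[OF inj] v by metis
      then show "y \<in> iso_verts hom ` neighbours G v"
        using uw by (auto simp: neighbours_def)
    next
      fix y assume "y \<in> iso_verts hom ` neighbours G v"
      then obtain w where w: "w \<in> neighbours G v" "y = iso_verts hom w"
        by auto
      then have "(v, w) \<in> arcs_ends H"
        using v closed[OF v] by (auto simp: ends neighbours_def)
      then show "y \<in> neighbours K (iso_verts hom v)"
        using w by (force simp: neighbours_def parcs)
    qed
  qed
qed

lemma neighbours_path_graph:
  assumes "n \<ge> 3"
  shows "neighbours (path_graph n) 0 = {1}" "neighbours (path_graph n) 1 = {0, 2}"
  using assms by (auto simp: neighbours_def path_graph_def)

text \<open>Conditionals replace \<open>mod\<close>, so that degrees and triangles become case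
  splits with linear arithmetic.\<close>

lemma neighbours_cycle_graph:
  assumes "n \<ge> 2" "i < n"
  shows "neighbours (cycle_graph n) i
    = {if Suc i = n then 0 else Suc i, if i = 0 then n - 1 else i - 1}"
proof -
  have mod: "Suc j mod n = (if Suc j = n then 0 else Suc j)" if "j < n" for j
    using that by simp
  have "neighbours (cycle_graph n) i = {j. j < n \<and> (j = Suc i mod n \<or> i = Suc j mod n)}"
    using assms(2) unfolding neighbours_def cycle_graph_def by simp
  also have "\<dots> = {j. j < n \<and>
      (j = (if Suc i = n then 0 else Suc i) \<or> i = (if Suc j = n then 0 else Suc j))}"
    using assms(2) by (intro Collect_cong conj_cong refl) (simp only: mod)
  also have "\<dots> = {if Suc i = n then 0 else Suc i, if i = 0 then n - 1 else i - 1}"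
    using assms by (auto split: if_splits)
  finally show ?thesis .
qed

lemma card_neighbours_cycle_graph:
  assumes "n \<ge> 3" "i < n"
  shows "card (neighbours (cycle_graph n) i) = 2"
  using assms by (auto simp: neighbours_cycle_graph card_insert_if)

text \<open>Three steps of plus or minus one add up to an odd number of absolute value at most 3,
  which no \<open>n \<ge> 4\<close> divides; hence no closed walk has length three.\<close>

lemma cycle_graph_triangle_free:
  assumes "n \<ge> 4" "i < n" "j \<in> neighbours (cycle_graph n) i"
  shows "neighbours (cycle_graph n) i \<inter> neighbours (cycle_graph n) j = {}"
proof -
  have "j < n"
    using assms(3) by (simp add: neighbours_def cycle_graph_def)
  then show ?thesis
    using assms by (auto simp: neighbours_cycle_graph split: if_splits)
qed

theorem theorem8:
  fixes P :: "'a set"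
    and f :: "'a \<Rightarrow> 'a \<Rightarrow> real"
    and G :: "'v pair_pre_digraph"
    and l :: "'a \<Rightarrow> real"
  assumes "finite P"
    and "pair_graph G"
    and "card (pverts G) = card P"
    and "one_dimensional P f l"
    and "inj_on l P"
    and "\<exists>H \<in> pre_digraph.sccs (with_proj G).
           (\<exists>n\<ge>3. digraph_iso H (with_proj (path_graph n))) \<or>
           (\<exists>n\<ge>4. digraph_iso H (with_proj (cycle_graph n)))"
  shows "\<not> (\<exists>\<sigma>. arrangement P G \<sigma> \<and> envy_free P f G \<sigma>)"
proof -
  have "\<not> envy_free P f G \<sigma>" if \<sigma>: "arrangement P G \<sigma>" for \<sigma>
  proof -
    obtain H where H: "H \<in> pre_digraph.sccs (with_proj G)"
      "(\<exists>n\<ge>3. digraph_iso H (with_proj (path_graph n))) \<or>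
       (\<exists>n\<ge>4. digraph_iso H (with_proj (cycle_graph n)))"
      using assms(6) by blast
    from H(2) show ?thesis
    proof (elim disjE exE conjE)
      fix n :: nat
      assume n: "n \<ge> 3" and iso: "digraph_iso H (with_proj (path_graph n))"
      obtain h where "verts H \<subseteq> pverts G" and h: "bij_betw h (verts H) (pverts (path_graph n))"
        "\<And>v. v \<in> verts H \<Longrightarrow> neighbours G v \<subseteq> verts H"
        "\<And>v. v \<in> verts H \<Longrightarrow> neighbours (path_graph n) (h v) = h ` neighbours G v"
        by (rule scc_iso_neighbours[OF assms(2) H(1) iso]) (rule that; simp)
      have inj: "inj_on h (verts H)"
        using h(1) by (simp add: bij_betw_def)
      have "0 \<in> h ` verts H"
        using h(1) n by (simp add: bij_betw_def path_graph_def)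
      then obtain v where v: "v \<in> verts H" "h v = 0"
        by auto
      have hNv: "h ` neighbours G v = {1}"
        using h(3)[OF v(1)] neighbours_path_graph[OF n] v by simp
      then obtain w where w: "w \<in> neighbours G v" "h w = 1"
        by (metis imageE singletonI)
      \<comment> \<open>Both sets lie in \<open>verts H\<close>, where \<open>h\<close> is
        injective, so equality of their images \<open>{1}\<close> can be pulled back.\<close>
      have Nv: "neighbours G v = {w}"
        using inj_on_image_eq_iff[OF inj, of "neighbours G v" "{w}"] h(2)[OF v(1)] hNv w by auto
      have "2 \<in> h ` neighbours G w"
        using h(3)[of w] h(2)[OF v(1)] neighbours_path_graph[OF n] w by auto
      then obtain x where x: "x \<in> neighbours G w" "h x = 2"
        by (metis imageE)
      then have "x \<noteq> v"
        using v by auto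
      then show ?thesis
        by (rule not_envy_free_leaf[OF assms(1,2) \<sigma> assms(4) Nv x(1)])
    next
      fix n :: nat
      assume n: "n \<ge> 4" and iso: "digraph_iso H (with_proj (cycle_graph n))"
      obtain h where h: "verts H \<subseteq> pverts G" "bij_betw h (verts H) (pverts (cycle_graph n))"
        "\<And>v. v \<in> verts H \<Longrightarrow> neighbours G v \<subseteq> verts H"
        "\<And>v. v \<in> verts H \<Longrightarrow> neighbours (cycle_graph n) (h v) = h ` neighbours G v"
        by (rule scc_iso_neighbours[OF assms(2) H(1) iso]) (rule that; simp)
      have lt: "h v < n" if "v \<in> verts H" for v
        using h(2) that by (auto simp: bij_betw_def cycle_graph_def)
      have inj: "inj_on h (verts H)"
        using h(2) by (simp add: bij_betw_def)
      show ?thesis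
      proof (rule not_envy_free_2_regular[OF assms(1,2) \<sigma> assms(4,5) h(1)])
        have "0 \<in> h ` verts H"
          using h(2) n by (simp add: bij_betw_def cycle_graph_def)
        then show "verts H \<noteq> {}"
          by auto
        show "neighbours G v \<subseteq> verts H" if "v \<in> verts H" for v
          using that by (rule h(3))
        show "card (neighbours G v) = 2" if v: "v \<in> verts H" for v
          using card_image[OF inj_on_subset[OF inj h(3)[OF v]]] h(4)[OF v]
            card_neighbours_cycle_graph[OF _ lt[OF v]] n by simp
        show "neighbours G u \<inter> neighbours G v = {}"
          if u: "u \<in> verts H" and v: "v \<in> neighbours G u" for u v
        proof -
          have vH: "v \<in> verts H"
            using h(3)[OF u] v by auto
          have "h v \<in> neighbours (cycle_graph n) (h u)"
            using h(4)[OF u] v by auto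
          then have "neighbours (cycle_graph n) (h u) \<inter> neighbours (cycle_graph n) (h v) = {}"
            by (rule cycle_graph_triangle_free[OF n lt[OF u]])
          \<comment> \<open>The image under \<open>h\<close> of a common neighbour of
            \<open>u\<close> and \<open>v\<close> would lie in this empty intersection.\<close>
          then show ?thesis
            using h(4)[OF u] h(4)[OF vH] by auto
        qed
      qed
    qed
  qed
  then show ?thesis
    by blast
qed

end
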